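(* Fix $\eta\in(0,1/2)$. For all integers $N\ge1$ and all odd primes $p$, with $\mathcal V=\mathcal V(p,N)$ and $A=A_{p,N}(\mathcal V,\mathcal V)=\frac1{\#\mathcal V^2}\sum_{\beta_1,\beta_2\in\mathcal V}\mathfrak d_{p,N}(\beta_1,\beta_2)^2$, \[ \frac1{\#\mathcal V^2}\#\Big\{(\beta_1,\beta_2)\in\mathcal V^2:\ \mathfrak d_{p,N}(\beta_1,\beta_2)\in\big[\sqrt A-p^{-\eta},\sqrt A+p^{-\eta}\big]\Big\}\ \ge\ 1-\frac{2}{p^{1-2\eta}}. \]
   Context: $\omega=\exp(2\pi i/p)$; $\mathcal V(p,N)=\{\sum_{j=1}^{p-1}a_j\omega^j: a_j\in\{-N,N\}\}$. For $\gamma\in\mathbb{Q}(\omega)$, $\mathrm{Tr}(\gamma)=\sum_{\sigma\in\mathrm{Gal}(\mathbb{Q}(\omega)/\mathbb{Q})}\sigma(\gamma)$, $\|\gamma\|=\big(\sum_{j=1}^{p-1}\mathrm{Tr}(\gamma\omega^j)^2\big)^{1/2}$, $\mathfrak d_{p,N}(\alpha,\beta)=\|\beta-\alpha\|/(2Np(p-1)^{1/2})$. *)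

theory Defs
  imports "HOL-Analysis.Analysis" "HOL-Algebra.Generated_Fields"
    "HOL-Algebra.Algebraic_Closure_Type"
begin

definition root_unity :: "nat \<Rightarrow> complex" where
  "root_unity p = exp (2 * of_real pi * \<i> / of_nat p)"

definition cyclotomic_field :: "nat \<Rightarrow> complex set" where
  "cyclotomic_field p = generate_field ring_of_type_algebra (\<rat> \<union> {root_unity p})"

abbreviation cyclotomic_ring :: "nat \<Rightarrow> complex ring" where
  "cyclotomic_ring p \<equiv> ring_of_type_algebra\<lparr>carrier := cyclotomic_field p\<rparr>"

text \<open>Functions are total, so automorphisms of the subfield are required to be
  extensional; otherwise each of them would be represented by infinitely many functions
  on the complex numbers and sums over the Galois group would be meaningless.\<close>

definition cyclotomic_Gal :: "nat \<Rightarrow> (complex \<Rightarrow> complex) set" where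
  "cyclotomic_Gal p =
     {\<sigma> \<in> ring_iso (cyclotomic_ring p) (cyclotomic_ring p) \<inter> extensional (cyclotomic_field p).
        \<forall>q\<in>\<rat>. \<sigma> q = q}"

definition Tr :: "nat \<Rightarrow> complex \<Rightarrow> complex" where
  "Tr p \<gamma> = (\<Sum>\<sigma>\<in>cyclotomic_Gal p. \<sigma> \<gamma>)"

text \<open>Traces of elements of the cyclotomic field are real (shown below in
  \<open>Tr_in_Reals\<close>), so nothing is lost by taking real parts.\<close>

definition trace_norm :: "nat \<Rightarrow> complex \<Rightarrow> real" where
  "trace_norm p \<gamma> = sqrt (\<Sum>j=1..p-1. (Re (Tr p (\<gamma> * root_unity p ^ j)))\<^sup>2)"

definition trace_dist :: "nat \<Rightarrow> nat \<Rightarrow> complex \<Rightarrow> complex \<Rightarrow> real" where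
  "trace_dist p N \<alpha> \<beta> = trace_norm p (\<beta> - \<alpha>) / (2 * real N * real p * sqrt (real p - 1))"

definition vertices :: "nat \<Rightarrow> nat \<Rightarrow> complex set" where
  "vertices p N =
     {(\<Sum>j=1..p-1. of_int (a j) * root_unity p ^ j) | a :: nat \<Rightarrow> int.
        \<forall>j\<in>{1..p-1}. a j \<in> {- int N, int N}}"

definition mean_sq_dist :: "nat \<Rightarrow> nat \<Rightarrow> real" where
  "mean_sq_dist p N =
     1 / (real (card (vertices p N)))\<^sup>2 *
       (\<Sum>\<beta>1\<in>vertices p N. \<Sum>\<beta>2\<in>vertices p N. (trace_dist p N \<beta>1 \<beta>2)\<^sup>2)"


lemma ring_of_type_algebra_simps [simp]:
  "carrier (ring_of_type_algebra :: complex ring) = UNIV"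
  "x \<otimes>\<^bsub>ring_of_type_algebra\<^esub> y = x * (y :: complex)"
  "x \<oplus>\<^bsub>ring_of_type_algebra\<^esub> y = x + (y :: complex)"
  "\<one>\<^bsub>ring_of_type_algebra\<^esub> = (1 :: complex)"
  "\<zero>\<^bsub>ring_of_type_algebra\<^esub> = (0 :: complex)"
  by (simp_all add: ring_of_type_algebra_def)

lemma complex_ring_a_inv [simp]: "\<ominus>\<^bsub>ring_of_type_algebra\<^esub> x = - (x :: complex)"
proof -
  interpret field "ring_of_type_algebra :: complex ring" by (rule field_from_type_algebra)
  show ?thesis using minus_equality[of "- x" x] by simp
qed

lemma complex_ring_m_inv [simp]:
  assumes "x \<noteq> 0"
  shows "inv\<^bsub>ring_of_type_algebra\<^esub> x = inverse (x :: complex)"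
proof -
  interpret field "ring_of_type_algebra :: complex ring" by (rule field_from_type_algebra)
  show ?thesis using comm_inv_char[of x "inverse x"] assms by simp
qed

lemma cyclotomic_field_closed:
  shows "q \<in> \<rat> \<Longrightarrow> q \<in> cyclotomic_field p"
    and "root_unity p \<in> cyclotomic_field p"
    and "x \<in> cyclotomic_field p \<Longrightarrow> - x \<in> cyclotomic_field p"
    and "x \<in> cyclotomic_field p \<Longrightarrow> inverse x \<in> cyclotomic_field p"
    and "x \<in> cyclotomic_field p \<Longrightarrow> y \<in> cyclotomic_field p \<Longrightarrow> x + y \<in> cyclotomic_field p"
    and "x \<in> cyclotomic_field p \<Longrightarrow> y \<in> cyclotomic_field p \<Longrightarrow> x * y \<in> cyclotomic_field p"
proof -
  note intros = generate_field.intros[where R = "ring_of_type_algebra :: complex ring"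
      and H = "\<rat> \<union> {root_unity p}", folded cyclotomic_field_def, simplified]
  show rat: "q \<in> \<rat> \<Longrightarrow> q \<in> cyclotomic_field p" for q using intros(2) by blast
  show "root_unity p \<in> cyclotomic_field p" using intros(2) by blast
  show "x \<in> cyclotomic_field p \<Longrightarrow> - x \<in> cyclotomic_field p" by (rule intros)
  show "x \<in> cyclotomic_field p \<Longrightarrow> inverse x \<in> cyclotomic_field p"
    using intros(4)[of x] rat[of 0] by (cases "x = 0") auto
  show "x \<in> cyclotomic_field p \<Longrightarrow> y \<in> cyclotomic_field p \<Longrightarrow> x + y \<in> cyclotomic_field p"
    by (rule intros)
  show "x \<in> cyclotomic_field p \<Longrightarrow> y \<in> cyclotomic_field p \<Longrightarrow> x * y \<in> cyclotomic_field p"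
    by (rule intros)
qed

lemma cyclotomic_field_induct [consumes 1, case_names rat root minus inverse add mult]:
  assumes "x \<in> cyclotomic_field p"
    and "\<And>q. q \<in> \<rat> \<Longrightarrow> P q" "P (root_unity p)"
    and "\<And>x. x \<in> cyclotomic_field p \<Longrightarrow> P x \<Longrightarrow> P (- x)"
    and "\<And>x. x \<in> cyclotomic_field p \<Longrightarrow> x \<noteq> 0 \<Longrightarrow> P x \<Longrightarrow> P (inverse x)"
    and "\<And>x y. x \<in> cyclotomic_field p \<Longrightarrow> y \<in> cyclotomic_field p \<Longrightarrow> P x \<Longrightarrow> P y \<Longrightarrow> P (x + y)"
    and "\<And>x y. x \<in> cyclotomic_field p \<Longrightarrow> y \<in> cyclotomic_field p \<Longrightarrow> P x \<Longrightarrow> P y \<Longrightarrow> P (x * y)"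
  shows "P x"
  using assms(1)[unfolded cyclotomic_field_def]
proof (induction rule: generate_field.induct)
  case one then show ?case using assms(2)[of 1] by simp
next
  case (incl h) then show ?case using assms(2,3) by auto
next
  case (a_inv h) then show ?case using assms(4)[of h] by (simp add: cyclotomic_field_def)
next
  case (m_inv h) then show ?case using assms(5)[of h] by (simp add: cyclotomic_field_def)
next
  case (eng_add x y) then show ?case using assms(6)[of x y] by (simp add: cyclotomic_field_def)
next
  case (eng_mult x y) then show ?case using assms(7)[of x y] by (simp add: cyclotomic_field_def)
qed

lemma cyclotomic_Gal_iff:
  "\<sigma> \<in> cyclotomic_Gal p \<longleftrightarrow>
     bij_betw \<sigma> (cyclotomic_field p) (cyclotomic_field p) \<and>
     \<sigma> \<in> extensional (cyclotomic_field p) \<and> (\<forall>q\<in>\<rat>. \<sigma> q = q) \<and>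
     (\<forall>x\<in>cyclotomic_field p. \<forall>y\<in>cyclotomic_field p.
        \<sigma> (x + y) = \<sigma> x + \<sigma> y \<and> \<sigma> (x * y) = \<sigma> x * \<sigma> y)"
  unfolding cyclotomic_Gal_def ring_iso_def ring_hom_def
  by (auto simp: bij_betw_def Rats_1)

lemma root_unity_power: "p > 0 \<Longrightarrow> root_unity p ^ p = 1"
  by (simp add: root_unity_def exp_of_nat_mult[symmetric] mult_ac)

lemma cnj_root_unity: "cnj (root_unity p) = inverse (root_unity p)"
  by (simp add: root_unity_def exp_cnj exp_minus[symmetric])

lemma cnj_Rats: "q \<in> \<rat> \<Longrightarrow> cnj q = q"
  by (elim Rats_cases') (simp add: complex_cnj_divide)

lemma cnj_cyclotomic_field: "x \<in> cyclotomic_field p \<Longrightarrow> cnj x \<in> cyclotomic_field p"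
proof (induction rule: cyclotomic_field_induct)
  case (rat q)
  then show ?case by (simp add: cnj_Rats cyclotomic_field_closed)
qed (auto simp: cnj_root_unity intro: cyclotomic_field_closed)

lemma cyclotomic_Gal_eqI:
  assumes "\<sigma> \<in> cyclotomic_Gal p" "\<tau> \<in> cyclotomic_Gal p" "\<sigma> (root_unity p) = \<tau> (root_unity p)"
  shows "\<sigma> = \<tau>"
proof (rule extensionalityI)
  show "\<sigma> \<in> extensional (cyclotomic_field p)" "\<tau> \<in> extensional (cyclotomic_field p)"
    using assms by (auto simp: cyclotomic_Gal_iff)
  have neg: "\<rho> (- x) = - \<rho> x" if "\<rho> \<in> cyclotomic_Gal p" "x \<in> cyclotomic_field p" for \<rho> x
  proof -
    have "\<rho> (x + - x) = \<rho> x + \<rho> (- x)" "\<rho> 0 = 0"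
      using that cyclotomic_field_closed(3) unfolding cyclotomic_Gal_iff by (blast, simp)
    then show ?thesis by (simp add: eq_neg_iff_add_eq_0 add.commute)
  qed
  have inv: "\<rho> (inverse x) = inverse (\<rho> x)"
    if "\<rho> \<in> cyclotomic_Gal p" "x \<in> cyclotomic_field p" "x \<noteq> 0" for \<rho> x
  proof -
    have "\<rho> (x * inverse x) = \<rho> x * \<rho> (inverse x)" "\<rho> 1 = 1"
      using that cyclotomic_field_closed(4) unfolding cyclotomic_Gal_iff by (blast, simp)
    with that(3) show ?thesis by (metis inverse_unique right_inverse)
  qed
  fix x assume "x \<in> cyclotomic_field p"
  then show "\<sigma> x = \<tau> x"
  proof (induction rule: cyclotomic_field_induct)
    case (rat q) then show ?case using assms by (simp add: cyclotomic_Gal_iff)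
  next
    case root show ?case by (rule assms)
  next
    case (minus x) then show ?case using neg[OF assms(1)] neg[OF assms(2)] by simp
  next
    case (inverse x) then show ?case using inv[OF assms(1)] inv[OF assms(2)] by simp
  next
    case (add x y) then show ?case using assms by (simp add: cyclotomic_Gal_iff)
  next
    case (mult x y) then show ?case using assms by (simp add: cyclotomic_Gal_iff)
  qed
qed

lemma finite_cyclotomic_Gal:
  assumes "p > 0"
  shows "finite (cyclotomic_Gal p)"
proof (rule finite_imageD)
  show "inj_on (\<lambda>\<sigma>. \<sigma> (root_unity p)) (cyclotomic_Gal p)"
    by (intro inj_onI) (rule cyclotomic_Gal_eqI)
  have "\<sigma> (root_unity p) ^ p = 1" if "\<sigma> \<in> cyclotomic_Gal p" for \<sigma>
  proof -
    have "root_unity p ^ n \<in> cyclotomic_field p \<and> \<sigma> (root_unity p ^ n) = \<sigma> (root_unity p) ^ n" for n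
    proof (induction n)
      case 0 then show ?case using that by (simp add: cyclotomic_Gal_iff cyclotomic_field_closed)
    next
      case (Suc n)
      then show ?case using that cyclotomic_field_closed(2)[of p]
        by (simp add: cyclotomic_Gal_iff cyclotomic_field_closed(6))
    qed
    from this[of p] root_unity_power[OF assms] that show ?thesis by (simp add: cyclotomic_Gal_iff)
  qed
  then show "finite ((\<lambda>\<sigma>. \<sigma> (root_unity p)) ` cyclotomic_Gal p)"
    by (intro finite_subset[OF _ finite_roots_unity[of p, where 'a = complex]]) (use assms in auto)
qed

lemma Tr_in_Reals:
  assumes "\<gamma> \<in> cyclotomic_field p"
  shows "Tr p \<gamma> \<in> \<real>"
proof -
  let ?K = "cyclotomic_field p"
  let ?c = "\<lambda>\<sigma>. restrict (\<lambda>x. cnj (\<sigma> x)) ?K"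
  have in_Gal: "?c \<sigma> \<in> cyclotomic_Gal p" if "\<sigma> \<in> cyclotomic_Gal p" for \<sigma>
  proof -
    have "bij_betw cnj ?K ?K"
      by (rule bij_betw_byWitness[where f' = cnj]) (auto simp: cnj_cyclotomic_field)
    with that have "bij_betw (cnj \<circ> \<sigma>) ?K ?K"
      by (auto simp: cyclotomic_Gal_iff intro: bij_betw_trans)
    then have "bij_betw (?c \<sigma>) ?K ?K" by (rule bij_betw_cong[THEN iffD1, rotated]) simp
    with that show ?thesis
      by (auto simp: cnj_Rats cyclotomic_Gal_iff cyclotomic_field_closed)
  qed
  have inv: "?c (?c \<sigma>) = \<sigma>" if "\<sigma> \<in> cyclotomic_Gal p" for \<sigma>
    by (rule extensionalityI[of _ ?K]) (use that in \<open>auto simp: cyclotomic_Gal_iff\<close>)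
  have "cnj (Tr p \<gamma>) = (\<Sum>\<sigma>\<in>cyclotomic_Gal p. ?c \<sigma> \<gamma>)"
    using assms by (simp add: Tr_def)
  also have "\<dots> = Tr p \<gamma>"
    unfolding Tr_def
    by (rule sum.reindex_bij_witness[where i = ?c and j = ?c]) (use in_Gal inv in auto)
  finally show ?thesis by (simp add: Reals_cnj_iff)
qed

end

theory Submission
  imports Defs "HOL-Computational_Algebra.Computational_Algebra" "HOL-Number_Theory.Cong"
begin

text \<open>
  The conjugates of the root of unity \<open>\<omega>\<close> are \<open>\<omega>\<^sup>k\<close> for \<open>0 < k < p\<close>, since the \<open>p\<close>-th cyclotomic
  polynomial is irreducible. Hence for \<open>\<gamma> = \<Sum> c\<^sub>i \<omega>\<^sup>i\<close> the trace norm satisfies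
  \<open>\<parallel>\<gamma>\<parallel>\<^sup>2 = p\<^sup>2 * (\<Sum> c\<^sub>i\<^sup>2) - (p + 1) * (\<Sum> c\<^sub>i)\<^sup>2\<close>. For the difference of two random vertices the
  \<open>x\<^sub>i = c\<^sub>i / (2 * N)\<close> are independent and take the values \<open>-1, 0, 1\<close> with probabilities
  \<open>1/4, 1/2, 1/4\<close>, so the squared distance has mean \<open>A = (p\<^sup>2 - p - 1) / (2 * p\<^sup>2)\<close> and variance
  \<open>(p ^ 4 - p\<^sup>2 - 4 * p - 3) / (4 * p ^ 4 * (p - 1)) \<le> 2 * A / p\<close>. If the distance \<open>d\<close> deviates from
  \<open>sqrt A\<close> by more than \<open>t\<close>, then \<open>\<bar>d\<^sup>2 - A\<bar> \<ge> t * sqrt A\<close>, and Chebyshev's inequality applies.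
\<close>

subsection \<open>Irreducibility of cyclotomic polynomials of prime order\<close>

text \<open>Let i be the least index at which q fails to divide a coefficient of g. Modulo q only
  \<open>poly.coeff g i * poly.coeff h 0\<close> survives in coefficient i of the product, so i is
  at least the degree of \<open>g * h\<close>. As i is at most the degree of g, h is constant, and
  its leading coefficient is a unit.\<close>

lemma eisenstein_constant_factor:
  fixes g h :: "int poly" and q :: int
  assumes q: "Factorial_Ring.prime q"
    and lead: "Polynomial.lead_coeff (g * h) = 1"
    and coeffs: "\<And>i. i < Polynomial.degree (g * h) \<Longrightarrow> q dvd poly.coeff (g * h) i"
    and g0: "q dvd poly.coeff g 0" and h0: "\<not> q dvd poly.coeff h 0"
  shows "h dvd 1"
proof -
  have gh: "Polynomial.lead_coeff g * Polynomial.lead_coeff h = 1"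
    using lead by (simp add: lead_coeff_mult)
  have nz: "g \<noteq> 0" "h \<noteq> 0" using gh by auto
  have unit: "Polynomial.lead_coeff g dvd 1" "Polynomial.lead_coeff h dvd 1" 
    using gh by (metis dvd_triv_left, metis dvd_triv_right)
  have "\<not> q dvd Polynomial.lead_coeff g"
    using unit(1) q by (meson dvd_trans not_prime_unit)
  then have ex: "\<exists>i. \<not> q dvd poly.coeff g i" by blast
  define i where "i = (LEAST i. \<not> q dvd poly.coeff g i)"
  have i: "\<not> q dvd poly.coeff g i" unfolding i_def by (rule LeastI_ex[OF ex])
  have below: "q dvd poly.coeff g j" if "j < i" for j
    using not_less_Least[of j "\<lambda>i. \<not> q dvd poly.coeff g i"] that i_def by blast
  have "poly.coeff (g * h) i = (\<Sum>j\<le>i. poly.coeff g j * poly.coeff h (i - j))"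
    by (rule coeff_mult)
  also have "\<dots> = (\<Sum>j<i. poly.coeff g j * poly.coeff h (i - j)) + poly.coeff g i * poly.coeff h 0"
    by (simp add: lessThan_Suc_atMost[symmetric])
  finally have eq: "poly.coeff (g * h) i = \<dots>" .
  have "q dvd (\<Sum>j<i. poly.coeff g j * poly.coeff h (i - j))"
    by (intro dvd_sum) (auto simp: below)
  moreover have "\<not> q dvd poly.coeff g i * poly.coeff h 0"
    using i h0 q by (simp add: prime_dvd_mult_iff)
  ultimately have "\<not> q dvd poly.coeff (g * h) i"
    unfolding eq using dvd_add_right_iff by blast
  then have "Polynomial.degree (g * h) \<le> i" using coeffs not_less by blast
  moreover have "i \<le> Polynomial.degree g" by (rule le_degree) (use i in auto)
  ultimately have "Polynomial.degree h = 0" using nz by (simp add: degree_mult_eq)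
  then show "h dvd 1"
    using unit(2) by (metis degree_eq_zeroE lead_coeff_pCons(2) is_unit_poly_iff pCons_eq_0_iff coeff_pCons_0 degree_pCons_0)
qed

text \<open>As q divides the constant coefficient of f and its square does not, exactly one factor
  has a constant coefficient divisible by q; the other factor is a unit by
  \<open>eisenstein_constant_factor\<close>.\<close>

lemma eisenstein_criterion:
  fixes f :: "int poly" and q :: int
  assumes q: "Factorial_Ring.prime q" and lead: "Polynomial.lead_coeff f = 1" and deg: "Polynomial.degree f > 0"
    and coeffs: "\<And>i. i < Polynomial.degree f \<Longrightarrow> q dvd poly.coeff f i"
    and sq: "\<not> q\<^sup>2 dvd poly.coeff f 0"
  shows "Factorial_Ring.irreducible f"
proof (rule Factorial_Ring.irreducibleI)
  show "f \<noteq> 0" using deg by auto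
  show "\<not> f dvd 1" using deg by (metis is_unit_polyE degree_pCons_0 less_irrefl)
next
  fix g h assume f: "f = g * h"
  have c0: "poly.coeff f 0 = poly.coeff g 0 * poly.coeff h 0" by (simp add: f coeff_mult_0)
  have "q dvd poly.coeff g 0 * poly.coeff h 0" using coeffs[OF deg] c0 by simp
  then consider "q dvd poly.coeff g 0" | "q dvd poly.coeff h 0"
    using q prime_dvd_mult_iff by blast
  then show "g dvd 1 \<or> h dvd 1"
  proof cases
    case 1
    then have "\<not> q dvd poly.coeff h 0"
      using sq c0 by (auto simp: power2_eq_square mult_dvd_mono)
    then show ?thesis using eisenstein_constant_factor[OF q, of g h] lead coeffs 1 by (simp add: f)
  next
    case 2
    then have "\<not> q dvd poly.coeff g 0"
      using sq c0 by (auto simp: power2_eq_square mult_dvd_mono)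
    then show ?thesis using eisenstein_constant_factor[OF q, of h g] lead coeffs 2
      by (simp add: f mult.commute)
  qed
qed

section \<open>Gauss's lemma: from integer to rational coefficients\<close>

lemma map_poly_of_int_mult:
  "map_poly of_int (f * g) = (map_poly of_int f * map_poly of_int g :: 'a :: {comm_ring_1, ring_char_0} poly)"
  by (rule poly_eqI) (simp add: coeff_map_poly coeff_mult)

lemma clear_denominators:
  fixes f :: "rat poly"
  obtains c :: int and F :: "int poly"
  where "c \<noteq> 0" "Polynomial.smult (of_int c) f = map_poly of_int F"
proof -
  have "\<exists>c F. c \<noteq> 0 \<and> Polynomial.smult (of_int c) f = map_poly of_int F"
  proof (induction f)
    case 0
    show ?case by (rule exI[of _ 1], rule exI[of _ 0]) simp
  next
    case (pCons a f)
    then obtain c F where cF: "c \<noteq> 0" "Polynomial.smult (of_int c) f = map_poly of_int F" by blast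
    obtain m n where a: "a = of_int m / of_int n" "n \<noteq> 0"
      by (metis Fract_of_int_quotient Rat_cases less_irrefl)
    have "Polynomial.smult (of_int (n * c)) (pCons a f) = pCons (of_int (c * m)) (Polynomial.smult (of_int n) (Polynomial.smult (of_int c) f))"
      using a by simp
    also have "\<dots> = map_poly of_int (pCons (c * m) (Polynomial.smult n F))"
      unfolding cF(2) by (simp add: map_poly_pCons map_poly_smult)
    finally show ?case using cF(1) a(2) by (metis mult_eq_0_iff)
  qed
  then show ?thesis using that by blast
qed

text \<open>Irreducible integer polynomials are prime. Clearing denominators in a rational
  factorization \<open>d * e\<close> shows that f divides \<open>D * E\<close>, hence D or E;
  comparing degrees leaves d or e constant.\<close>

lemma irreducible_map_poly_rat:
  fixes f :: "int poly"
  assumes irr: "Factorial_Ring.irreducible f" and deg: "Polynomial.degree f > 0"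
  shows "Factorial_Ring.irreducible (map_poly of_int f :: rat poly)"
proof (rule Factorial_Ring.irreducibleI)
  have degF: "Polynomial.degree (map_poly of_int f :: rat poly) = Polynomial.degree f"
    by (rule degree_map_poly) simp
  show nz: "(map_poly of_int f :: rat poly) \<noteq> 0" using deg degF by force
  show "\<not> (map_poly of_int f :: rat poly) dvd 1"
    using deg degF by (metis is_unit_polyE degree_pCons_0 less_irrefl)
  fix d e :: "rat poly" assume de: "map_poly of_int f = d * e"
  have "prime_elem f" using irr by (rule irreducible_imp_prime_poly)
  obtain c D where D: "c \<noteq> 0" "Polynomial.smult (of_int c) d = map_poly of_int D" by (rule clear_denominators)
  obtain c' E where E: "c' \<noteq> 0" "Polynomial.smult (of_int c') e = map_poly of_int E" by (rule clear_denominators)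
  have nz': "d \<noteq> 0" "e \<noteq> 0" using de nz by auto
  have "map_poly of_int (D * E) = Polynomial.smult (of_int (c * c')) (d * e)"
    by (simp add: map_poly_of_int_mult D(2)[symmetric] E(2)[symmetric] mult.commute)
  also have "\<dots> = map_poly of_int (Polynomial.smult (c * c') f)"
    unfolding de[symmetric] by (subst map_poly_smult) simp_all
  finally have eq: "map_poly of_int (D * E) = (map_poly of_int (Polynomial.smult (c * c') f) :: rat poly)" .
  have "D * E = Polynomial.smult (c * c') f"
  proof (rule poly_eqI)
    fix n
    have "(of_int (poly.coeff (D * E) n) :: rat) = of_int (poly.coeff (Polynomial.smult (c * c') f) n)"
      using arg_cong[OF eq, of "\<lambda>f. poly.coeff f n"] by (simp only: coeff_map_poly of_int_0)
    then show "poly.coeff (D * E) n = poly.coeff (Polynomial.smult (c * c') f) n"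
      by (simp only: of_int_eq_iff)
  qed
  then have "f dvd D * E" by (simp add: dvd_smult)
  then have fde: "f dvd D \<or> f dvd E" using \<open>prime_elem f\<close> prime_elem_dvd_mult_iff by blast
  have degD: "Polynomial.degree D = Polynomial.degree d"
    using arg_cong[OF D(2), of Polynomial.degree] D(1) by (simp add: degree_map_poly)
  have degE: "Polynomial.degree E = Polynomial.degree e"
    using arg_cong[OF E(2), of Polynomial.degree] E(1) by (simp add: degree_map_poly)
  have DE: "D \<noteq> 0" "E \<noteq> 0" using D E nz' by auto
  have "Polynomial.degree f = Polynomial.degree d + Polynomial.degree e"
    using degF de nz' by (metis degree_mult_eq)
  moreover have "Polynomial.degree f \<le> Polynomial.degree d \<or> Polynomial.degree f \<le> Polynomial.degree e"
    using fde dvd_imp_degree_le[of f D] dvd_imp_degree_le[of f E] DE degD degE by auto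
  ultimately have "Polynomial.degree d = 0 \<or> Polynomial.degree e = 0" by linarith
  then show "d dvd 1 \<or> e dvd 1"
    using nz' is_unit_iff_degree by blast
qed

section \<open>Cyclotomic polynomials of prime order\<close>

text \<open>For prime p this is the p-th cyclotomic polynomial \<open>(x^p - 1) / (x - 1)\<close>.
  The coefficient ring is left open because irreducibility is proved over the integers and used over
  the rationals.\<close>

definition prime_cyclotomic :: "nat \<Rightarrow> 'a::comm_ring_1 poly" where
  "prime_cyclotomic p = (\<Sum>i<p. Polynomial.monom 1 i)"

lemma coeff_prime_cyclotomic: "poly.coeff (prime_cyclotomic p) i = (if i < p then 1 else 0)"
  by (simp add: prime_cyclotomic_def coeff_sum)

lemma degree_prime_cyclotomic:
  assumes "p > 0"
  shows "Polynomial.degree (prime_cyclotomic p :: 'a::comm_ring_1 poly) = p - 1"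
proof (rule antisym)
  show "Polynomial.degree (prime_cyclotomic p :: 'a poly) \<le> p - 1"
    by (rule degree_le) (auto simp: coeff_prime_cyclotomic)
  show "p - 1 \<le> Polynomial.degree (prime_cyclotomic p :: 'a poly)"
    by (rule le_degree) (use assms in \<open>simp add: coeff_prime_cyclotomic\<close>)
qed

lemma pcompose_monom_one: "pcompose (Polynomial.monom 1 n) q = (q ^ n :: 'a::comm_ring_1 poly)"
  by (induction n) (simp_all add: monom_Suc pcompose_pCons monom_0 one_pCons)

text \<open>Replacing x by \<open>x + 1\<close> in the geometric sum gives
  \<open>x * f(x + 1) = (x + 1)^p - 1\<close>. The factor x appears as \<open>pCons 0\<close> and
  explains the index \<open>Suc i\<close>.\<close>

lemma coeff_prime_cyclotomic_shift:
  "poly.coeff (pcompose (prime_cyclotomic p) [:1, 1:]) i = (of_nat (p choose Suc i) :: 'a::comm_ring_1)"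
proof -
  let ?f = "pcompose (prime_cyclotomic p) [:1, 1:] :: 'a poly"
  have "pCons 0 ?f = ([:1, 1:] - 1) * (\<Sum>i<p. [:1, 1:] ^ i)"
    by (simp add: prime_cyclotomic_def pcompose_sum pcompose_monom_one one_pCons)
  also have "\<dots> = [:1, 1:] ^ p - 1"
    by (rule power_diff_1_eq[symmetric])
  finally have "poly.coeff (pCons 0 ?f) (Suc i) = poly.coeff ([:1, 1:] ^ p - 1) (Suc i)" by simp
  also have "\<dots> = of_nat (p choose Suc i)"
  proof (cases "Suc i \<le> p")
    case True
    then show ?thesis by (simp add: coeff_linear_poly_power del: binomial_Suc_Suc)
  next
    case False
    then have "Polynomial.degree ([:1, 1:] ^ p :: 'a poly) < Suc i"
      using degree_power_le[of "[:1, 1:] :: 'a poly" p] by simp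
    with False show ?thesis by (simp add: coeff_eq_0 binomial_eq_0 del: binomial_Suc_Suc)
  qed
  finally show ?thesis by simp
qed

text \<open>Eisenstein's criterion at p applies to the shifted polynomial: its coefficients are
  binomial coefficients divisible by p below the top one, and its constant coefficient is p itself.
  Factorizations transfer along the shift.\<close>

lemma irreducible_prime_cyclotomic_int:
  assumes p: "Factorial_Ring.prime p"
  shows "Factorial_Ring.irreducible (prime_cyclotomic p :: int poly)"
proof -
  have p2: "p \<ge> 2" using p by (rule prime_ge_2_nat)
  let ?f = "prime_cyclotomic p :: int poly"
  let ?g = "pcompose ?f [:1, 1:]"
  have deg: "Polynomial.degree ?g = p - 1"
    using p2 by (simp add: degree_pcompose degree_prime_cyclotomic)
  have "Factorial_Ring.irreducible ?g"
  proof (rule eisenstein_criterion[of "int p"])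
    show "Factorial_Ring.prime (int p)" using p by simp
    show "Polynomial.lead_coeff ?g = 1" unfolding deg using p2 by (simp add: coeff_prime_cyclotomic_shift del: binomial_Suc_Suc)
    show "Polynomial.degree ?g > 0" using deg p2 by simp
    show "int p dvd poly.coeff ?g i" if "i < Polynomial.degree ?g" for i
    proof -
      have "p dvd (p choose Suc i)"
        by (rule dvd_choose_prime) (use that deg p in auto)
      then show ?thesis by (simp add: coeff_prime_cyclotomic_shift del: binomial_Suc_Suc)
    qed
    have "\<not> p\<^sup>2 dvd p"
      using p2 dvd_imp_le[of "p\<^sup>2" p] by (auto simp: power2_eq_square)
    moreover have "poly.coeff ?g 0 = int p"
      unfolding coeff_prime_cyclotomic_shift by simp
    ultimately show "\<not> (int p)\<^sup>2 dvd poly.coeff ?g 0"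
      by (simp only: of_nat_dvd_iff of_nat_power[symmetric] not_False_eq_True)
  qed
  then have irr: "g dvd 1 \<or> h dvd 1" if "?g = g * h" for g h
    using that Factorial_Ring.irreducibleD by blast
  show ?thesis
  proof (rule Factorial_Ring.irreducibleI)
    have d: "Polynomial.degree ?f > 0" using p2 by (simp add: degree_prime_cyclotomic)
    then show "?f \<noteq> 0" by auto
    show "\<not> ?f dvd 1" using d by (metis is_unit_polyE degree_pCons_0 less_irrefl)
    \<comment> \<open>The shift preserves degrees and fixes constants, so units pull back.\<close>
    have unit: "r dvd 1" if "pcompose r [:1, 1:] dvd 1" for r :: "int poly"
    proof -
      have "Polynomial.degree (pcompose r [:1, 1:]) = 0" 
        using that by (metis is_unit_polyE degree_pCons_0)
      then have "Polynomial.degree r = 0" by (simp add: degree_pcompose)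
      then obtain a where "r = [:a:]" by (rule degree_eq_zeroE)
      with that show ?thesis by simp
    qed
    show "g dvd 1 \<or> h dvd 1" if "?f = g * h" for g h
    proof -
      have "?g = pcompose g [:1, 1:] * pcompose h [:1, 1:]" using that by (simp add: pcompose_mult)
      from irr[OF this] show ?thesis using unit by blast
    qed
  qed
qed

lemma irreducible_prime_cyclotomic_rat:
  assumes p: "Factorial_Ring.prime p"
  shows "Factorial_Ring.irreducible (prime_cyclotomic p :: rat poly)"
proof -
  have "map_poly of_int (prime_cyclotomic p) = (prime_cyclotomic p :: rat poly)"
    by (rule poly_eqI) (simp add: coeff_map_poly coeff_prime_cyclotomic)
  moreover have "Polynomial.degree (prime_cyclotomic p :: int poly) > 0"
    using prime_ge_2_nat[OF p] by (simp add: degree_prime_cyclotomic)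
  ultimately show ?thesis
    using irreducible_map_poly_rat[OF irreducible_prime_cyclotomic_int[OF p]] by simp
qed

subsection \<open>The Galois group and the trace\<close>

text \<open>The ring homomorphism from rational polynomials to the complex numbers sending the
  variable to z. Field elements and automorphisms are handled through representing
  polynomials.\<close>

definition rat_poly_eval :: "rat poly \<Rightarrow> complex \<Rightarrow> complex" where
  "rat_poly_eval q z = poly (map_poly of_rat q) z"

lemma rat_poly_eval_0 [simp]: "rat_poly_eval 0 z = 0"
  and rat_poly_eval_pCons [simp]: "rat_poly_eval (pCons a q) z = of_rat a + z * rat_poly_eval q z"
  by (simp_all add: rat_poly_eval_def map_poly_pCons)

lemma rat_poly_eval_1 [simp]: "rat_poly_eval 1 z = 1"
  by (simp add: one_pCons)

lemma rat_poly_eval_add [simp]: "rat_poly_eval (f + g) z = rat_poly_eval f z + rat_poly_eval g z"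
  by (induction f g rule: poly_induct2) (simp_all add: of_rat_add algebra_simps)

lemma rat_poly_eval_smult [simp]: "rat_poly_eval (Polynomial.smult c f) z = of_rat c * rat_poly_eval f z"
  by (induction f) (simp_all add: of_rat_mult algebra_simps)

lemma rat_poly_eval_minus [simp]: "rat_poly_eval (- f) z = - rat_poly_eval f z"
  using rat_poly_eval_smult[of "-1" f z] by (simp add: of_rat_minus)

lemma rat_poly_eval_diff [simp]: "rat_poly_eval (f - g) z = rat_poly_eval f z - rat_poly_eval g z"
  using rat_poly_eval_add[of f "- g" z] by simp

lemma rat_poly_eval_mult [simp]: "rat_poly_eval (f * g) z = rat_poly_eval f z * rat_poly_eval g z"
  by (induction f) (simp_all add: algebra_simps)

lemma rat_poly_eval_pcompose [simp]:
  "rat_poly_eval (pcompose f g) z = rat_poly_eval f (rat_poly_eval g z)"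
  by (induction f) (simp_all add: pcompose_pCons)

lemma rat_poly_eval_monom [simp]: "rat_poly_eval (Polynomial.monom c n) z = of_rat c * z ^ n"
  by (simp add: rat_poly_eval_def map_poly_monom poly_monom)

lemma rat_poly_eval_sum [simp]: "rat_poly_eval (sum f A) z = (\<Sum>i\<in>A. rat_poly_eval (f i) z)"
  by (induction A rule: infinite_finite_induct) simp_all

lemma rat_poly_eval_prime_cyclotomic:
  assumes "z ^ p = 1" "z \<noteq> 1"
  shows "rat_poly_eval (prime_cyclotomic p) z = 0"
  using power_diff_1_eq[of z p] assms by (simp add: prime_cyclotomic_def)

text \<open>Over a field, irreducible polynomials are prime, hence coprime to whatever they do not
  divide.\<close>

lemma bezout_prime_cyclotomic:
  assumes p: "Factorial_Ring.prime p" and q: "\<not> prime_cyclotomic p dvd (q :: rat poly)"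
  obtains u v where "u * prime_cyclotomic p + v * q = 1"
proof -
  have "prime_elem (prime_cyclotomic p :: rat poly)"
    using irreducible_prime_cyclotomic_rat[OF p] by (rule field_poly_irreducible_imp_prime)
  then have "coprime (prime_cyclotomic p) q" using q by (rule prime_elem_imp_coprime)
  then have "gcd (prime_cyclotomic p) q = 1" by simp
  then show ?thesis using that bezout_coefficients_fst_snd by metis
qed

text \<open>This identifies the minimal polynomial of every nontrivial p-th root of unity: if it did
  not divide q, the Bezout identity at z would read 0 = 1.\<close>

lemma rat_poly_eval_eq_0_iff:
  assumes p: "Factorial_Ring.prime p" and z: "z ^ p = 1" "z \<noteq> 1"
  shows "rat_poly_eval q z = 0 \<longleftrightarrow> prime_cyclotomic p dvd q"
proof
  assume "prime_cyclotomic p dvd q"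
  then show "rat_poly_eval q z = 0" by (elim dvdE) (simp add: rat_poly_eval_prime_cyclotomic[OF z])
next
  assume 0: "rat_poly_eval q z = 0"
  show "prime_cyclotomic p dvd q"
  proof (rule ccontr)
    assume "\<not> prime_cyclotomic p dvd q"
    with p obtain u v where "u * prime_cyclotomic p + v * q = 1" by (rule bezout_prime_cyclotomic)
    then have "rat_poly_eval (u * prime_cyclotomic p + v * q) z = 1" by simp
    then show False by (simp add: 0 rat_poly_eval_prime_cyclotomic[OF z])
  qed
qed

section \<open>The field generated by the root of unity and its automorphisms\<close>

lemma root_unity_power_eq_1_iff:
  assumes "p > 0"
  shows "root_unity p ^ m = 1 \<longleftrightarrow> p dvd m"
proof -
  have "root_unity p ^ m = exp (2 * of_real pi * \<i> * of_nat m / of_nat p)"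
    by (simp add: root_unity_def exp_of_nat_mult[symmetric] mult_ac)
  then show ?thesis using complex_root_unity_eq_1[of p m] assms by simp
qed

lemma root_unity_power_mod:
  assumes "p > 0"
  shows "root_unity p ^ (m mod p) = root_unity p ^ m"
proof -
  have "root_unity p ^ m = root_unity p ^ (m div p * p + m mod p)" by simp
  also have "\<dots> = root_unity p ^ (m mod p)"
    using root_unity_power[OF assms] by (simp only: power_add mult.commute[of "m div p"] power_mult power_one mult_1)
  finally show ?thesis by simp
qed

text \<open>Polynomial values at \<omega> form a ring containing the rationals and \<omega>. For the
  inverse of a nonzero value of f, the Bezout identity evaluated at \<omega> exhibits the cofactor
  of f.\<close>

lemma cyclotomic_field_eq:
  assumes p: "Factorial_Ring.prime p"
  shows "cyclotomic_field p = range (\<lambda>q. rat_poly_eval q (root_unity p))"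
proof (intro equalityI subsetI)
  have p2: "p \<ge> 2" using p by (rule prime_ge_2_nat)
  let ?w = "root_unity p"
  have w: "?w ^ p = 1" "?w \<noteq> 1"
    using root_unity_power_eq_1_iff[of p p] root_unity_power_eq_1_iff[of p 1] p2 by auto
  fix x assume "x \<in> cyclotomic_field p"
  then show "x \<in> range (\<lambda>q. rat_poly_eval q ?w)"
  proof (induction rule: cyclotomic_field_induct)
    case (rat q)
    then obtain r where "q = of_rat r" by (rule Rats_cases)
    then show ?case by (intro image_eqI[of _ _ "[:r:]"]) simp_all
  next
    case root
    show ?case by (intro image_eqI[of _ _ "[:0, 1:]"]) simp_all
  next
    case (minus x)
    then obtain f where "x = rat_poly_eval f ?w" by blast
    then show ?case by (intro image_eqI[of _ _ "- f"]) simp_all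
  next
    case (inverse x)
    then obtain f where f: "x = rat_poly_eval f ?w" by blast
    then have "\<not> prime_cyclotomic p dvd f"
      using inverse.hyps(2) rat_poly_eval_eq_0_iff[OF p w] by blast
    with p obtain u v where "u * prime_cyclotomic p + v * f = 1" by (rule bezout_prime_cyclotomic)
    then have "rat_poly_eval (u * prime_cyclotomic p + v * f) ?w = 1" by simp
    then have "rat_poly_eval v ?w * x = 1" by (simp add: f rat_poly_eval_prime_cyclotomic[OF w])
    then have "inverse x = rat_poly_eval v ?w" by (metis inverse_unique mult.commute)
    then show ?case by blast
  next
    case (add x y)
    then obtain f g where "x = rat_poly_eval f ?w" "y = rat_poly_eval g ?w" by blast
    then show ?case by (intro image_eqI[of _ _ "f + g"]) simp_all
  next
    case (mult x y)
    then obtain f g where "x = rat_poly_eval f ?w" "y = rat_poly_eval g ?w" by blast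
    then show ?case by (intro image_eqI[of _ _ "f * g"]) simp_all
  qed
next
  fix x assume "x \<in> range (\<lambda>q. rat_poly_eval q (root_unity p))"
  then obtain q where x: "x = rat_poly_eval q (root_unity p)" by blast
  show "x \<in> cyclotomic_field p"
    unfolding x by (induction q) (simp_all add: cyclotomic_field_closed)
qed

lemma cyclotomic_Gal_rat_poly_eval:
  assumes p: "Factorial_Ring.prime p" and \<sigma>: "\<sigma> \<in> cyclotomic_Gal p"
  shows "\<sigma> (rat_poly_eval q (root_unity p)) = rat_poly_eval q (\<sigma> (root_unity p))"
proof (induction q)
  case 0
  show ?case using \<sigma> by (simp add: cyclotomic_Gal_iff)
next
  case (pCons a q)
  have K: "rat_poly_eval q (root_unity p) \<in> cyclotomic_field p" 
    by (simp add: cyclotomic_field_eq[OF p])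
  have "(of_rat a :: complex) \<in> \<rat>" by simp
  with \<sigma> K pCons.IH show ?case
    by (simp add: cyclotomic_Gal_iff cyclotomic_field_closed)
qed

text \<open>An automorphism maps \<omega> to a p-th root of unity, that is to some power of
  \<omega>; injectivity excludes the value 1.\<close>

lemma cyclotomic_Gal_root:
  assumes p: "Factorial_Ring.prime p" and \<sigma>: "\<sigma> \<in> cyclotomic_Gal p"
  obtains k where "k \<in> {1..p-1}" "\<sigma> (root_unity p) = root_unity p ^ k"
proof -
  have p2: "p \<ge> 2" using p by (rule prime_ge_2_nat)
  have w: "root_unity p ^ p = 1" "root_unity p \<noteq> 1"
    using root_unity_power_eq_1_iff[of p p] root_unity_power_eq_1_iff[of p 1] p2 by auto
  have hom: "\<sigma> 1 = 1" "inj_on \<sigma> (cyclotomic_field p)"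
    using \<sigma> by (auto simp: cyclotomic_Gal_iff bij_betw_def)
  have "\<sigma> (rat_poly_eval (Polynomial.monom 1 p) (root_unity p)) = \<sigma> (root_unity p) ^ p"
    by (subst cyclotomic_Gal_rat_poly_eval[OF p \<sigma>]) simp
  then have "\<sigma> (root_unity p) ^ p = 1" using w hom by simp
  then obtain j where j: "j < p" "\<sigma> (root_unity p) = exp (2 * of_real pi * \<i> * of_nat j / of_nat p)"
    using complex_roots_unity[of p] p2 by auto
  then have eq: "\<sigma> (root_unity p) = root_unity p ^ j"
    by (simp add: root_unity_def exp_of_nat_mult[symmetric] mult_ac)
  have "j \<noteq> 0"
  proof
    assume "j = 0"
    then have "\<sigma> (root_unity p) = \<sigma> 1" using eq hom by simp
    then have "root_unity p = 1"
      by (rule inj_onD[OF hom(2)]) (auto intro: cyclotomic_field_closed)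
    then show False using w by simp
  qed
  then show ?thesis using that[of j] j eq by auto
qed

text \<open>Since \<omega> and its k-th power have the same minimal polynomial, sending
  \<open>f(\<omega>)\<close> to \<open>f(\<omega>^k)\<close> is well defined and injective.\<close>

lemma cyclotomic_Gal_exists:
  assumes p: "Factorial_Ring.prime p" and k: "k \<in> {1..p-1}"
  obtains \<sigma> where "\<sigma> \<in> cyclotomic_Gal p" "\<sigma> (root_unity p) = root_unity p ^ k"
proof -
  have p2: "p \<ge> 2" using p by (rule prime_ge_2_nat)
  have not_dvd: "\<not> p dvd k" using k p2 by (auto dest: dvd_imp_le)
  let ?w = "root_unity p" and ?K = "cyclotomic_field p" and ?ev = "rat_poly_eval"
  let ?z = "?w ^ k"
  note K = cyclotomic_field_eq[OF p]
  have w: "?w ^ p = 1" "?w \<noteq> 1"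
    using root_unity_power_eq_1_iff[of p p] root_unity_power_eq_1_iff[of p 1] p2 by auto
  have z: "?z ^ p = 1" "?z \<noteq> 1"
    using root_unity_power_eq_1_iff[of p "k * p"] root_unity_power_eq_1_iff[of p k] p2 not_dvd
    by (auto simp: power_mult)
  have eq_iff: "?ev f ?w = ?ev g ?w \<longleftrightarrow> ?ev f ?z = ?ev g ?z" for f g
    using rat_poly_eval_eq_0_iff[OF p w, of "f - g"] rat_poly_eval_eq_0_iff[OF p z, of "f - g"] by simp
  \<comment> \<open>\<open>SOME\<close> picks a representing polynomial; by \<open>eq_iff\<close>
    the choice does not affect the value. The restriction provides extensionality.\<close>
  define \<sigma> where "\<sigma> = restrict (\<lambda>x. ?ev (SOME f. ?ev f ?w = x) ?z) ?K"
  have \<sigma>: "\<sigma> (?ev f ?w) = ?ev f ?z" for f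
  proof -
    have "?ev (SOME g. ?ev g ?w = ?ev f ?w) ?w = ?ev f ?w"
      by (rule someI[of "\<lambda>g. ?ev g ?w = ?ev f ?w" f]) simp
    then show ?thesis unfolding \<sigma>_def using eq_iff by (simp add: K)
  qed
  \<comment> \<open>With m inverse to k modulo p, \<omega> is the m-th power of \<open>?z\<close>,
    so composing f with \<open>x^m\<close> gives a preimage of \<open>f(\<omega>)\<close>. This
    yields surjectivity.\<close>
  obtain m where m: "[k * m = 1] (mod p)"
    using cong_solve_coprime_nat[of k p] not_dvd p
    by (metis One_nat_def coprime_commute prime_imp_coprime)
  have "?w ^ (k * m) = ?w ^ 1"
    using m root_unity_power_mod[of p "k * m"] root_unity_power_mod[of p 1] p2
    by (simp add: cong_def)
  then have zm: "?z ^ m = ?w" by (simp add: power_mult)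
  have "bij_betw \<sigma> ?K ?K"
    unfolding bij_betw_def
  proof
    show "inj_on \<sigma> ?K" by (auto simp: inj_on_def K \<sigma> eq_iff)
    have "?ev f ?z \<in> ?K" for f
    proof -
      have "?ev f ?z = ?ev (pcompose f (Polynomial.monom 1 k)) ?w" by simp
      then show ?thesis unfolding K by blast
    qed
    moreover have "?ev f ?w \<in> \<sigma> ` ?K" for f
    proof (rule image_eqI)
      show "?ev f ?w = \<sigma> (?ev (pcompose f (Polynomial.monom 1 m)) ?w)" unfolding \<sigma> by (simp add: zm)
      show "?ev (pcompose f (Polynomial.monom 1 m)) ?w \<in> ?K" unfolding K by blast
    qed
    ultimately show "\<sigma> ` ?K = ?K" by (auto simp: K \<sigma>)
  qed
  moreover have "\<sigma> \<in> extensional ?K" by (simp add: \<sigma>_def)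
  moreover have "\<sigma> x = x" if x: "x \<in> \<rat>" for x
  proof -
    obtain r where "x = of_rat r" using x by (rule Rats_cases)
    then show ?thesis using \<sigma>[of "[:r:]"] by simp
  qed
  moreover have "\<sigma> (x + y) = \<sigma> x + \<sigma> y \<and> \<sigma> (x * y) = \<sigma> x * \<sigma> y" if xy: "x \<in> ?K" "y \<in> ?K" for x y
  proof -
    obtain f g where fg: "x = ?ev f ?w" "y = ?ev g ?w" using xy unfolding K by blast
    then show ?thesis using \<sigma>[of "f + g"] \<sigma>[of "f * g"] \<sigma>[of f] \<sigma>[of g] by simp
  qed
  ultimately have "\<sigma> \<in> cyclotomic_Gal p" by (auto simp: cyclotomic_Gal_iff)
  moreover have "\<sigma> ?w = ?z" using \<sigma>[of "[:0, 1:]"] by simp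
  ultimately show ?thesis by (rule that)
qed

text \<open>An automorphism is determined by the image of \<omega>, and these images are exactly the
  powers with exponent from 1 to p - 1, so the sum over the Galois group can be reindexed by
  exponents.\<close>

lemma Tr_rat_poly_eval:
  assumes p: "Factorial_Ring.prime p"
  shows "Tr p (rat_poly_eval q (root_unity p)) = (\<Sum>k=1..p-1. rat_poly_eval q (root_unity p ^ k))"
proof -
  have p2: "p \<ge> 2" using p by (rule prime_ge_2_nat)
  let ?w = "root_unity p"
  have image: "(\<lambda>\<sigma>. \<sigma> ?w) ` cyclotomic_Gal p = (\<lambda>k. ?w ^ k) ` {1..p-1}"
  proof (intro equalityI subsetI; elim imageE)
    fix z \<sigma> assume z: "z = \<sigma> ?w" and \<sigma>: "\<sigma> \<in> cyclotomic_Gal p"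
    obtain k where "k \<in> {1..p-1}" "\<sigma> ?w = ?w ^ k" by (rule cyclotomic_Gal_root[OF p \<sigma>])
    then show "z \<in> (\<lambda>k. ?w ^ k) ` {1..p-1}" using z by blast
  next
    fix z k assume z: "z = ?w ^ k" and k: "k \<in> {1..p-1}"
    obtain \<sigma> where "\<sigma> \<in> cyclotomic_Gal p" "\<sigma> ?w = ?w ^ k" by (rule cyclotomic_Gal_exists[OF p k])
    then show "z \<in> (\<lambda>\<sigma>. \<sigma> ?w) ` cyclotomic_Gal p" using z by (intro image_eqI[of _ _ \<sigma>]) auto
  qed
  have "?w \<noteq> 0" by (simp add: root_unity_def)
  have inj_power: "inj_on (\<lambda>k. ?w ^ k) {1..p-1}"
  proof (rule linorder_inj_onI')
    fix i j assume ij: "i \<in> {1..p-1}" "j \<in> {1..p-1}" "i < j"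
    then have "\<not> p dvd j - i" by (auto dest: dvd_imp_le)
    then have "?w ^ (j - i) \<noteq> 1" using root_unity_power_eq_1_iff[of p] p2 by simp
    moreover have "?w ^ j = ?w ^ i * ?w ^ (j - i)" using ij(3) by (simp flip: power_add)
    ultimately show "?w ^ i \<noteq> ?w ^ j" using \<open>?w \<noteq> 0\<close> by auto
  qed
  have "Tr p (rat_poly_eval q ?w) = (\<Sum>\<sigma>\<in>cyclotomic_Gal p. rat_poly_eval q (\<sigma> ?w))"
    by (simp add: Tr_def cyclotomic_Gal_rat_poly_eval[OF p])
  also have "\<dots> = (\<Sum>z\<in>(\<lambda>\<sigma>. \<sigma> ?w) ` cyclotomic_Gal p. rat_poly_eval q z)"
    by (subst sum.reindex) (auto intro!: inj_onI cyclotomic_Gal_eqI)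
  also have "\<dots> = (\<Sum>k=1..p-1. rat_poly_eval q (?w ^ k))"
    unfolding image by (subst sum.reindex[OF inj_power]) simp
  finally show ?thesis .
qed

section \<open>The trace form in powers of the root of unity\<close>

text \<open>Over all \<open>k < p\<close> the geometric sum is p or 0; removing the term at k = 0
  subtracts 1.\<close>

lemma sum_root_unity_power:
  assumes p: "p \<ge> 2"
  shows "(\<Sum>k=1..p-1. root_unity p ^ (m * k)) = of_int (if p dvd m then int p - 1 else - 1)"
proof -
  let ?z = "root_unity p ^ m"
  have "(\<Sum>k<p. ?z ^ k) = 1 + (\<Sum>k=1..p-1. ?z ^ k)"
  proof -
    have "{..<p} = insert 0 {1..p-1}" using p by auto
    then show ?thesis by simp
  qed
  moreover have "(\<Sum>k<p. ?z ^ k) = (if p dvd m then of_nat p else 0)"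
  proof (cases "p dvd m")
    case True
    then show ?thesis using root_unity_power_eq_1_iff[of p m] p by simp
  next
    case False
    have "?z ^ p = 1" using root_unity_power_eq_1_iff[of p "m * p"] p by (simp add: power_mult)
    then show ?thesis
      using False root_unity_power_eq_1_iff[of p m] p power_diff_1_eq[of ?z p] by simp
  qed
  ultimately have "1 + (\<Sum>k=1..p-1. ?z ^ k) = (if p dvd m then of_nat p else 0)" by metis
  then have "(\<Sum>k=1..p-1. ?z ^ k) = (if p dvd m then of_nat p else 0) - 1" by (metis add_diff_cancel_left')
  then show ?thesis by (simp add: power_mult)
qed

text \<open>The trace of \<open>\<omega>^(i + j)\<close> is -1 unless p divides
  \<open>i + j\<close>, which in this range means \<open>i = p - j\<close>; there it is p - 1. Every
  coefficient thus contributes its negative, and the one at \<open>p - j\<close> an additional p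
  times itself.\<close>

lemma Tr_times_root_unity_power:
  fixes c :: "nat \<Rightarrow> int"
  assumes p: "Factorial_Ring.prime p" and j: "j \<in> {1..p-1}"
  shows "Tr p ((\<Sum>i=1..p-1. of_int (c i) * root_unity p ^ i) * root_unity p ^ j) =
    of_int (int p * c (p - j) - (\<Sum>i=1..p-1. c i))"
proof -
  have p2: "p \<ge> 2" using p by (rule prime_ge_2_nat)
  let ?w = "root_unity p"
  let ?q = "\<Sum>i=1..p-1. Polynomial.monom (of_int (c i)) (i + j) :: rat poly"
  have eq: "(\<Sum>i=1..p-1. of_int (c i) * ?w ^ i) * ?w ^ j = rat_poly_eval ?q ?w"
    by (simp add: sum_distrib_right power_add mult.assoc del: One_nat_def)
  have "Tr p ((\<Sum>i=1..p-1. of_int (c i) * ?w ^ i) * ?w ^ j) =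
      (\<Sum>k=1..p-1. \<Sum>i=1..p-1. of_int (c i) * (?w ^ k) ^ (i + j))"
    unfolding eq Tr_rat_poly_eval[OF p] by simp
  also have "\<dots> = (\<Sum>i=1..p-1. of_int (c i) * (\<Sum>k=1..p-1. ?w ^ ((i + j) * k)))"
    by (subst sum.swap) (simp add: sum_distrib_left power_mult[symmetric] mult.commute)
  also have "\<dots> = of_int (\<Sum>i=1..p-1. c i * (if p dvd i + j then int p - 1 else - 1))"
    unfolding sum_root_unity_power[OF p2] by simp
  also have "(\<Sum>i=1..p-1. c i * (if p dvd i + j then int p - 1 else - 1)) =
      (\<Sum>i=1..p-1. (if i = p - j then int p * c i else 0) - c i)"
  proof (rule sum.cong[OF refl])
    fix i assume i: "i \<in> {1..p-1}"
    have "p dvd i + j \<longleftrightarrow> i = p - j"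
    proof
      assume "p dvd i + j"
      then obtain m where m: "i + j = p * m" by (elim dvdE)
      moreover have "0 < i + j" "i + j < p * 2" using i j p2 by auto
      ultimately have "0 < m" "m < 2" by (metis mult_0_right not_gr0, metis mult_less_cancel1)
      then have "m = 1" by linarith
      then show "i = p - j" using m by simp
    qed (use j in auto)
    then show "c i * (if p dvd i + j then int p - 1 else - 1) = (if i = p - j then int p * c i else 0) - c i"
      by (simp add: algebra_simps)
  qed
  also have "\<dots> = int p * c (p - j) - (\<Sum>i=1..p-1. c i)"
  proof -
    have "p - j \<in> {1..p-1}" using j by auto
    then show ?thesis by (simp add: sum_subtractf)
  qed
  finally show ?thesis .
qed

text \<open>After reflecting j to \<open>p - j\<close>, the squares are expanded: the cross terms
  give \<open>- 2 * p * S^2\<close> and the constant terms \<open>(p - 1) * S^2\<close>, where S is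
  the sum of the coefficients.\<close>

lemma trace_norm_square:
  fixes c :: "nat \<Rightarrow> int"
  assumes p: "Factorial_Ring.prime p"
  shows "(trace_norm p (\<Sum>i=1..p-1. of_int (c i) * root_unity p ^ i))\<^sup>2 =
    (real p)\<^sup>2 * (\<Sum>i=1..p-1. (real_of_int (c i))\<^sup>2) - (real p + 1) * (\<Sum>i=1..p-1. real_of_int (c i))\<^sup>2"
proof -
  have p2: "p \<ge> 2" using p by (rule prime_ge_2_nat)
  let ?S = "\<Sum>i=1..p-1. real_of_int (c i)"
  have "(trace_norm p (\<Sum>i=1..p-1. of_int (c i) * root_unity p ^ i))\<^sup>2 =
      (\<Sum>j=1..p-1. (Re (Tr p ((\<Sum>i=1..p-1. of_int (c i) * root_unity p ^ i) * root_unity p ^ j)))\<^sup>2)"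
    by (simp add: trace_norm_def sum_nonneg)
  also have "\<dots> = (\<Sum>j=1..p-1. (real p * of_int (c (p - j)) - ?S)\<^sup>2)"
    by (rule sum.cong[OF refl], subst Tr_times_root_unity_power[OF p]) auto
  also have "\<dots> = (\<Sum>j=1..p-1. (real p * of_int (c j) - ?S)\<^sup>2)"
    by (rule sum.reindex_bij_witness[where i = "\<lambda>j. p - j" and j = "\<lambda>j. p - j"]) auto
  also have "\<dots> = (\<Sum>j=1..p-1. (real p)\<^sup>2 * (of_int (c j))\<^sup>2 - 2 * real p * ?S * of_int (c j) + ?S\<^sup>2)"
    by (rule sum.cong) (auto simp: power2_eq_square algebra_simps)
  also have "\<dots> = (real p)\<^sup>2 * (\<Sum>j=1..p-1. (of_int (c j))\<^sup>2) - 2 * real p * ?S * ?S + real (p - 1) * ?S\<^sup>2"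
    by (simp add: sum.distrib sum_subtractf sum_distrib_left)
  also have "\<dots> = (real p)\<^sup>2 * (\<Sum>j=1..p-1. (of_int (c j))\<^sup>2) - (real p + 1) * ?S\<^sup>2"
    using p2 by (simp add: of_nat_diff power2_eq_square algebra_simps)
  finally show ?thesis .
qed

text \<open>The trace form is positive definite by Cauchy--Schwarz, as \<open>(p + 1) * (p - 1) < p\<^sup>2\<close>;
  this gives the linear independence of the powers of the root of unity.\<close>

lemma root_unity_powers_independent:
  fixes c :: "nat \<Rightarrow> int"
  assumes p: "Factorial_Ring.prime p" and 0: "(\<Sum>i=1..p-1. of_int (c i) * root_unity p ^ i) = 0"
    and i: "i \<in> {1..p-1}"
  shows "c i = 0"
proof -
  have p2: "p \<ge> 2" using p by (rule prime_ge_2_nat)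
  let ?Q = "\<Sum>i=1..p-1. (real_of_int (c i))\<^sup>2" and ?S = "\<Sum>i=1..p-1. real_of_int (c i)"
  have "trace_norm p 0 = 0"
    using trace_norm_square[OF p, of "\<lambda>_. 0"] by simp
  then have "(real p)\<^sup>2 * ?Q = (real p + 1) * ?S\<^sup>2"
    using trace_norm_square[OF p, of c] unfolding 0 by simp
  also have "\<dots> \<le> (real p + 1) * (?Q * (real p - 1))"
    using sum_squared_le_sum_of_squares[of "\<lambda>i. real_of_int (c i)" "{1..p-1}"] p2
    by (intro mult_left_mono) (simp_all add: of_nat_diff)
  finally have "?Q \<le> 0" by (simp add: algebra_simps power2_eq_square)
  then have "?Q = 0" by (simp add: antisym sum_nonneg)
  then show ?thesis using i by (simp add: sum_nonneg_eq_0_iff)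
qed

subsection \<open>Moments over pairs of sign vectors\<close>

lemma sum_PiE_insert:
  assumes "x \<notin> I"
  shows "(\<Sum>g\<in>Pi\<^sub>E (insert x I) B. F g) = (\<Sum>g\<in>Pi\<^sub>E I B. \<Sum>y\<in>B x. F (g(x := y)))"
proof -
  have "(\<Sum>g\<in>Pi\<^sub>E (insert x I) B. F g) = (\<Sum>(y, g)\<in>B x \<times> Pi\<^sub>E I B. F (g(x := y)))"
    unfolding PiE_insert_eq by (subst sum.reindex[OF inj_combinator[OF assms]]) (auto intro: sum.cong)
  also have "\<dots> = (\<Sum>y\<in>B x. \<Sum>g\<in>Pi\<^sub>E I B. F (g(x := y)))"
    by (rule sum.cartesian_product[symmetric])
  finally show ?thesis by (simp add: sum.swap[of _ "B x"])
qed

definition sign_vectors :: "'a set \<Rightarrow> ('a \<Rightarrow> int) set" where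
  "sign_vectors I = (I \<rightarrow>\<^sub>E {-1, 1})"

text \<open>Coordinate difference of two vertices divided by 2N; on sign vectors it takes the values
  -1, 0 and 1.\<close>

definition half_diff :: "('a \<Rightarrow> int) \<Rightarrow> ('a \<Rightarrow> int) \<Rightarrow> 'a \<Rightarrow> real" where
  "half_diff e e' i = (real_of_int (e' i) - real_of_int (e i)) / 2"

text \<open>F receives the sum s and the sum of squares q of the half differences, the two
  statistics that determine the distance. For finite I the value is \<open>4 ^ card I\<close> times
  an expectation over random pairs.\<close>

definition sum_pairs :: "'a set \<Rightarrow> (real \<Rightarrow> real \<Rightarrow> real) \<Rightarrow> real" where
  "sum_pairs I F = (\<Sum>e\<in>sign_vectors I. \<Sum>e'\<in>sign_vectors I.
     F (\<Sum>i\<in>I. half_diff e e' i) (\<Sum>i\<in>I. (half_diff e e' i)\<^sup>2))"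

lemma sum_pairs_empty: "sum_pairs {} F = F 0 0"
  by (simp add: sum_pairs_def sign_vectors_def)

text \<open>Among the four sign choices at x, the half difference is 1 once, -1 once and 0 twice.
  All moments below follow from this recursion by induction.\<close>

lemma sum_pairs_insert:
  assumes I: "finite I" "x \<notin> I"
  shows "sum_pairs (insert x I) F =
    sum_pairs I (\<lambda>s q. F (s + 1) (q + 1) + F (s - 1) (q + 1) + 2 * F s q)"
proof -
  \<comment> \<open>A general h serves both statistics: the identity for s, squaring for q.\<close>
  have upd: "(\<Sum>i\<in>insert x I. h (half_diff (e(x := y)) (e'(x := y')) i)) =
      h ((real_of_int y' - real_of_int y) / 2) + (\<Sum>i\<in>I. h (half_diff e e' i))"
    for h :: "real \<Rightarrow> real" and e e' y y'
  proof -
    have "(\<Sum>i\<in>I. h (half_diff (e(x := y)) (e'(x := y')) i)) = (\<Sum>i\<in>I. h (half_diff e e' i))"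
      using I(2) by (intro sum.cong) (auto simp: half_diff_def)
    then show ?thesis using I by (simp add: half_diff_def)
  qed
  show ?thesis
    unfolding sum_pairs_def sign_vectors_def sum_PiE_insert[OF I(2)]
      upd[of "\<lambda>z. z"] upd[of "\<lambda>z. z\<^sup>2"]
    by (intro sum.cong refl)
      (simp add: sum.swap[of _ "{-1, 1}"] sum.distrib[symmetric] add_ac)
qed

lemma sum_pairs_add: "sum_pairs I (\<lambda>s q. F s q + G s q) = sum_pairs I F + sum_pairs I G"
  by (simp add: sum_pairs_def sum.distrib)

lemma sum_pairs_cmult: "sum_pairs I (\<lambda>s q. c * F s q) = c * sum_pairs I F"
  by (simp add: sum_pairs_def sum_distrib_left)

section \<open>Moments of the sum and the sum of squares\<close>

lemma sum_pairs_const: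
  assumes "finite I"
  shows "sum_pairs I (\<lambda>s q. c) = 4 ^ card I * c"
  using assms
proof (induction I)
  case (insert x I)
  have "sum_pairs (insert x I) (\<lambda>s q. c) = sum_pairs I (\<lambda>s q. 4 * c)"
    unfolding sum_pairs_insert[OF insert.hyps] by (simp add: algebra_simps)
  then show ?case using insert by (simp add: sum_pairs_cmult)
qed (simp add: sum_pairs_empty)

lemma sum_pairs_q:
  assumes "finite I"
  shows "sum_pairs I (\<lambda>s q. q) = 4 ^ card I * (card I / 2)"
  using assms
proof (induction I)
  case (insert x I)
  have "sum_pairs (insert x I) (\<lambda>s q. q) = sum_pairs I (\<lambda>s q. 4 * q + 2)"
    unfolding sum_pairs_insert[OF insert.hyps] by (simp add: algebra_simps)
  then show ?case
    unfolding sum_pairs_add sum_pairs_cmult insert.IH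
      sum_pairs_const[OF insert.hyps(1)]
    using insert.hyps by (simp add: field_simps power2_eq_square)
qed (simp add: sum_pairs_empty)

lemma sum_pairs_s2:
  assumes "finite I"
  shows "sum_pairs I (\<lambda>s q. s\<^sup>2) = 4 ^ card I * (card I / 2)"
  using assms
proof (induction I)
  case (insert x I)
  have "sum_pairs (insert x I) (\<lambda>s q. s\<^sup>2) = sum_pairs I (\<lambda>s q. 4 * s\<^sup>2 + 2)"
    unfolding sum_pairs_insert[OF insert.hyps] by (simp add: algebra_simps power2_eq_square)
  then show ?case
    unfolding sum_pairs_add sum_pairs_cmult insert.IH
      sum_pairs_const[OF insert.hyps(1)]
    using insert.hyps by (simp add: field_simps power2_eq_square)
qed (simp add: sum_pairs_empty)

text \<open>The statistic q is binomial with n trials and success probability 1/2, so its variance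
  n/4 is added to the squared mean.\<close>

lemma sum_pairs_q2:
  assumes "finite I"
  shows "sum_pairs I (\<lambda>s q. q\<^sup>2) = 4 ^ card I * ((real (card I) + (real (card I))\<^sup>2) / 4)"
  using assms
proof (induction I)
  case (insert x I)
  have "sum_pairs (insert x I) (\<lambda>s q. q\<^sup>2) = sum_pairs I (\<lambda>s q. 4 * q\<^sup>2 + (4 * q + 2))"
    unfolding sum_pairs_insert[OF insert.hyps] by (simp add: algebra_simps power2_eq_square)
  then show ?case
    unfolding sum_pairs_add sum_pairs_cmult insert.IH
      sum_pairs_const[OF insert.hyps(1)] sum_pairs_q[OF insert.hyps(1)]
    using insert.hyps by (simp add: field_simps power2_eq_square)
qed (simp add: sum_pairs_empty)

text \<open>The value agrees with the second moment of q, since the cross terms of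
  \<open>s^2\<close> are odd in single coordinates and q is even; the proof obtains it from the
  recursion.\<close>

lemma sum_pairs_q_s2:
  assumes "finite I"
  shows "sum_pairs I (\<lambda>s q. q * s\<^sup>2) = 4 ^ card I * ((real (card I) + (real (card I))\<^sup>2) / 4)"
  using assms
proof (induction I)
  case (insert x I)
  have "sum_pairs (insert x I) (\<lambda>s q. q * s\<^sup>2) =
      sum_pairs I (\<lambda>s q. 4 * (q * s\<^sup>2) + (2 * s\<^sup>2 + (2 * q + 2)))"
    unfolding sum_pairs_insert[OF insert.hyps] by (simp add: algebra_simps power2_eq_square)
  then show ?case
    unfolding sum_pairs_add sum_pairs_cmult insert.IH
      sum_pairs_const[OF insert.hyps(1)] sum_pairs_q[OF insert.hyps(1)] sum_pairs_s2[OF insert.hyps(1)]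
    using insert.hyps by (simp add: field_simps power2_eq_square)
qed (simp add: sum_pairs_empty)

text \<open>As s is half a sum of 2n independent signs, this is the fourth moment
  \<open>3 * (2 * n)^2 - 2 * (2 * n)\<close> of that sum divided by 16.\<close>

lemma sum_pairs_s4:
  assumes "finite I"
  shows "sum_pairs I (\<lambda>s q. s ^ 4) = 4 ^ card I * ((3 * (real (card I))\<^sup>2 - real (card I)) / 4)"
  using assms
proof (induction I)
  case (insert x I)
  have "sum_pairs (insert x I) (\<lambda>s q. s ^ 4) = sum_pairs I (\<lambda>s q. 4 * s ^ 4 + (12 * s\<^sup>2 + 2))"
    unfolding sum_pairs_insert[OF insert.hyps]
    by (simp add: algebra_simps power2_eq_square power4_eq_xxxx)
  then show ?case
    unfolding sum_pairs_add sum_pairs_cmult insert.IH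
      sum_pairs_const[OF insert.hyps(1)] sum_pairs_s2[OF insert.hyps(1)]
    using insert.hyps by (simp add: field_simps power2_eq_square)
qed (simp add: sum_pairs_empty)

section \<open>Chebyshev's inequality for a square root\<close>

text \<open>For a point outside the interval, \<open>d^2 - A\<close> factors into
  \<open>d - sqrt A\<close>, of size at least t, and \<open>d + sqrt A\<close>, at least
  \<open>sqrt A\<close>. It contributes at least \<open>t^2 * A\<close> to the sum, so the factor A
  in the variance bound cancels.\<close>

lemma chebyshev_sqrt:
  fixes d :: "'a \<Rightarrow> real" and A t v :: real
  assumes Y: "finite Y" and d: "\<And>x. x \<in> Y \<Longrightarrow> d x \<ge> 0"
    and A: "A > 0" and t: "t > 0"
    and var: "(\<Sum>x\<in>Y. ((d x)\<^sup>2 - A)\<^sup>2) \<le> card Y * (A * v)"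
  shows "real (card {x \<in> Y. d x \<in> {sqrt A - t..sqrt A + t}}) \<ge> card Y * (1 - v / t\<^sup>2)"
proof -
  define good where "good = {x \<in> Y. d x \<in> {sqrt A - t..sqrt A + t}}"
  have bad: "t\<^sup>2 * A \<le> ((d x)\<^sup>2 - A)\<^sup>2" if x: "x \<in> Y - good" for x
  proof -
    have far: "t \<le> \<bar>d x - sqrt A\<bar>" using x by (auto simp: good_def)
    have "(d x)\<^sup>2 - A = (d x - sqrt A) * (d x + sqrt A)"
      using A by (simp add: algebra_simps power2_eq_square)
    then have "((d x)\<^sup>2 - A)\<^sup>2 = (d x - sqrt A)\<^sup>2 * (d x + sqrt A)\<^sup>2"
      by (simp add: power_mult_distrib)
    moreover have "t\<^sup>2 \<le> (d x - sqrt A)\<^sup>2"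
      using far t by (simp add: abs_le_square_iff[symmetric])
    moreover have "A \<le> (d x + sqrt A)\<^sup>2"
    proof -
      have "(sqrt A)\<^sup>2 \<le> (d x + sqrt A)\<^sup>2" using d[of x] x A by (intro power_mono) auto
      then show ?thesis using A by simp
    qed
    ultimately show ?thesis using A by (simp add: mult_mono)
  qed
  have "card (Y - good) * (t\<^sup>2 * A) \<le> (\<Sum>x\<in>Y - good. ((d x)\<^sup>2 - A)\<^sup>2)"
    using sum_bounded_below[of "Y - good" "t\<^sup>2 * A" "\<lambda>x. ((d x)\<^sup>2 - A)\<^sup>2"] bad by simp
  also have "\<dots> \<le> (\<Sum>x\<in>Y. ((d x)\<^sup>2 - A)\<^sup>2)"
    using Y by (intro sum_mono2) auto
  also note var
  finally have "card (Y - good) * t\<^sup>2 \<le> card Y * v" using A by (simp add: field_simps)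
  then have "card (Y - good) \<le> card Y * (v / t\<^sup>2)" using t by (simp add: field_simps)
  moreover have "real (card (Y - good)) = card Y - card good"
  proof -
    have "good \<subseteq> Y" by (auto simp: good_def)
    then show ?thesis using Y by (simp add: card_Diff_subset finite_subset card_mono of_nat_diff)
  qed
  ultimately show ?thesis unfolding good_def[symmetric] by (simp add: algebra_simps)
qed

section \<open>Mean and variance of a combination of the two statistics\<close>

lemma sum_pairs_mean:
  assumes "finite I"
  shows "sum_pairs I (\<lambda>s q. a * q - b * s\<^sup>2) = 4 ^ card I * ((a - b) * card I / 2)"
proof -
  have "sum_pairs I (\<lambda>s q. a * q - b * s\<^sup>2) = sum_pairs I (\<lambda>s q. a * q + (- b) * s\<^sup>2)"
    by simp
  also have "\<dots> = 4 ^ card I * ((a - b) * card I / 2)"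
    unfolding sum_pairs_add sum_pairs_cmult sum_pairs_q[OF assms] sum_pairs_s2[OF assms]
    by (simp add: algebra_simps diff_divide_distrib)
  finally show ?thesis .
qed

text \<open>The square expands into six monomials with known moments. After inserting m, the only
  term quadratic in n is the one with \<open>b^2\<close>.\<close>

lemma sum_pairs_variance:
  fixes a b :: real
  assumes "finite I"
  defines "n \<equiv> real (card I)"
  defines "m \<equiv> (a - b) * n / 2"
  shows "sum_pairs I (\<lambda>s q. (a * q - b * s\<^sup>2 - m)\<^sup>2) =
    4 ^ card I * ((a\<^sup>2 * n - 2 * a * b * n + b\<^sup>2 * (2 * n\<^sup>2 - n)) / 4)"
proof -
  have "sum_pairs I (\<lambda>s q. (a * q - b * s\<^sup>2 - m)\<^sup>2) =
    sum_pairs I (\<lambda>s q. a\<^sup>2 * q\<^sup>2 + (b\<^sup>2 * s ^ 4 + ((- 2 * a * b) * (q * s\<^sup>2) +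
      ((- 2 * a * m) * q + ((2 * b * m) * s\<^sup>2 + m\<^sup>2)))))"
    by (rule arg_cong[of _ _ "sum_pairs I"]) (auto simp: fun_eq_iff algebra_simps power2_eq_square power4_eq_xxxx)
  also have "\<dots> = 4 ^ card I * (a\<^sup>2 * ((n + n\<^sup>2) / 4) + b\<^sup>2 * ((3 * n\<^sup>2 - n) / 4) - 2 * a * b * ((n + n\<^sup>2) / 4)
      - 2 * a * m * (n / 2) + 2 * b * m * (n / 2) + m\<^sup>2)"
    unfolding sum_pairs_add sum_pairs_cmult sum_pairs_const[OF assms(1)] sum_pairs_q[OF assms(1)]
      sum_pairs_s2[OF assms(1)] sum_pairs_q2[OF assms(1)] sum_pairs_q_s2[OF assms(1)]
      sum_pairs_s4[OF assms(1)] n_def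
    by (simp add: add_divide_distrib diff_divide_distrib algebra_simps)
  also have "\<dots> = 4 ^ card I * ((a\<^sup>2 * n - 2 * a * b * n + b\<^sup>2 * (2 * n\<^sup>2 - n)) / 4)"
  proof -
    \<comment> \<open>Multiplying by 4 leaves m only as \<open>2 * m\<close>, which is free of
      fractions.\<close>
    have "4 * (a\<^sup>2 * ((n + n\<^sup>2) / 4) + b\<^sup>2 * ((3 * n\<^sup>2 - n) / 4) - 2 * a * b * ((n + n\<^sup>2) / 4)
        - 2 * a * m * (n / 2) + 2 * b * m * (n / 2) + m\<^sup>2) =
      a\<^sup>2 * (n + n\<^sup>2) + b\<^sup>2 * (3 * n\<^sup>2 - n) - 2 * a * b * (n + n\<^sup>2) - (2 * a - 2 * b) * (2 * m) * n + (2 * m)\<^sup>2"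
      by (simp add: add_divide_distrib diff_divide_distrib algebra_simps)
    also have "2 * m = (a - b) * n" by (simp add: m_def)
    also have "a\<^sup>2 * (n + n\<^sup>2) + b\<^sup>2 * (3 * n\<^sup>2 - n) - 2 * a * b * (n + n\<^sup>2) -
        (2 * a - 2 * b) * ((a - b) * n) * n + ((a - b) * n)\<^sup>2 = a\<^sup>2 * n - 2 * a * b * n + b\<^sup>2 * (2 * n\<^sup>2 - n)"
      by (simp add: algebra_simps power2_eq_square)
    finally show ?thesis by simp
  qed
  finally show ?thesis .
qed

subsection \<open>Concentration of distances between vertices\<close>

text \<open>Pulling N out of the coefficients makes the index set independent of N.\<close>

definition sign_vertex :: "nat \<Rightarrow> nat \<Rightarrow> (nat \<Rightarrow> int) \<Rightarrow> complex" where
  "sign_vertex p N e = (\<Sum>j=1..p-1. of_int (int N * e j) * root_unity p ^ j)"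

text \<open>Injectivity is the linear independence of the powers of \<omega>; without it, counting
  vertices and counting sign vectors could differ.\<close>

lemma bij_betw_sign_vertex:
  assumes p: "Factorial_Ring.prime p" and N: "N \<ge> 1"
  shows "bij_betw (sign_vertex p N) (sign_vectors {1..p-1}) (vertices p N)"
  unfolding bij_betw_def
proof
  show "inj_on (sign_vertex p N) (sign_vectors {1..p-1})"
  proof (rule inj_onI)
    fix e e' assume e: "e \<in> sign_vectors {1..p-1}" and e': "e' \<in> sign_vectors {1..p-1}"
      and eq: "sign_vertex p N e = sign_vertex p N e'"
    have "(\<Sum>j=1..p-1. of_int (int N * e j - int N * e' j) * root_unity p ^ j) = 0"
      using eq by (simp add: sign_vertex_def sum_subtractf algebra_simps)
    then have "int N * e j - int N * e' j = 0" if "j \<in> {1..p-1}" for j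
      using root_unity_powers_independent[OF p, of "\<lambda>j. int N * e j - int N * e' j" j] that by blast
    then have "e j = e' j" if "j \<in> {1..p-1}" for j using that N by simp
    then show "e = e'"
      using e e' unfolding sign_vectors_def by (intro PiE_ext) auto
  qed
  show "sign_vertex p N ` sign_vectors {1..p-1} = vertices p N"
  proof (intro equalityI subsetI)
    fix x assume "x \<in> sign_vertex p N ` sign_vectors {1..p-1}"
    then obtain e where e: "e \<in> sign_vectors {1..p-1}" "x = sign_vertex p N e" by blast
    show "x \<in> vertices p N"
      unfolding vertices_def
    proof (intro CollectI exI conjI)
      show "x = (\<Sum>j=1..p-1. of_int (int N * e j) * root_unity p ^ j)"
        by (simp add: e sign_vertex_def)
      show "\<forall>j\<in>{1..p-1}. int N * e j \<in> {- int N, int N}"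
      proof
        fix j assume "j \<in> {1..p-1}"
        then have "e j \<in> {-1, 1}" using e(1) unfolding sign_vectors_def by (rule PiE_mem[rotated])
        then show "int N * e j \<in> {- int N, int N}" by auto
      qed
    qed
  next
    fix x assume "x \<in> vertices p N"
    then obtain a where a: "x = (\<Sum>j=1..p-1. of_int (a j) * root_unity p ^ j)"
      "\<forall>j\<in>{1..p-1}. a j \<in> {- int N, int N}"
      unfolding vertices_def by blast
    \<comment> \<open>Each coefficient is N or -N with N positive, so its sign is its quotient by
      N.\<close>
    define e where "e = restrict (\<lambda>j. sgn (a j)) {1..p-1}"
    have ae: "int N * e j = a j" if "j \<in> {1..p-1}" for j
    proof -
      have "a j = - int N \<or> a j = int N" using a(2) that by blast
      then show ?thesis using that N by (auto simp: e_def sgn_if)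
    qed
    have "e \<in> sign_vectors {1..p-1}"
      using a(2) N by (auto simp: e_def sign_vectors_def PiE_iff sgn_if)
    moreover have "sign_vertex p N e = x"
      unfolding sign_vertex_def a(1) by (rule sum.cong) (simp_all only: ae)
    ultimately show "x \<in> sign_vertex p N ` sign_vectors {1..p-1}" by blast
  qed
qed

text \<open>The difference has coordinates 2N times the half differences, and the normalization
  cancels this factor. What remains is a combination of q and \<open>s^2\<close> independent of
  N.\<close>

lemma trace_dist_sign_vertex:
  assumes p: "Factorial_Ring.prime p" and N: "N \<ge> 1"
  shows "(trace_dist p N (sign_vertex p N e) (sign_vertex p N e'))\<^sup>2 =
    1 / (real p - 1) * (\<Sum>i=1..p-1. (half_diff e e' i)\<^sup>2)
    - (real p + 1) / ((real p)\<^sup>2 * (real p - 1)) * (\<Sum>i=1..p-1. half_diff e e' i)\<^sup>2"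
proof -
  have p2: "real p \<ge> 2" using prime_ge_2_nat[OF p] by simp
  let ?Q = "\<Sum>i=1..p-1. (half_diff e e' i)\<^sup>2" and ?S = "\<Sum>i=1..p-1. half_diff e e' i"
  define c where "c j = int N * (e' j - e j)" for j
  have c: "real_of_int (c j) = 2 * real N * half_diff e e' j" for j
    by (simp add: c_def half_diff_def)
  have "sign_vertex p N e' - sign_vertex p N e = (\<Sum>i=1..p-1. of_int (c i) * root_unity p ^ i)"
    by (simp add: sign_vertex_def c_def sum_subtractf algebra_simps)
  then have "(trace_norm p (sign_vertex p N e' - sign_vertex p N e))\<^sup>2 =
      (real p)\<^sup>2 * (\<Sum>i=1..p-1. (2 * real N * half_diff e e' i)\<^sup>2)
      - (real p + 1) * (\<Sum>i=1..p-1. 2 * real N * half_diff e e' i)\<^sup>2"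
    using trace_norm_square[OF p, of c] by (simp only: c)
  also have "\<dots> = (2 * real N)\<^sup>2 * ((real p)\<^sup>2 * ?Q - (real p + 1) * ?S\<^sup>2)"
    by (simp add: power_mult_distrib sum_distrib_left[symmetric] algebra_simps)
  finally have "(trace_dist p N (sign_vertex p N e) (sign_vertex p N e'))\<^sup>2 =
      (2 * real N)\<^sup>2 * ((real p)\<^sup>2 * ?Q - (real p + 1) * ?S\<^sup>2) / ((2 * real N)\<^sup>2 * ((real p)\<^sup>2 * (real p - 1)))"
    using p2 by (simp add: trace_dist_def power_divide power_mult_distrib)
  also have "\<dots> = ((real p)\<^sup>2 * ?Q - (real p + 1) * ?S\<^sup>2) / ((real p)\<^sup>2 * (real p - 1))"
    using N by (subst mult_divide_mult_cancel_left) auto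
  also have "\<dots> = 1 / (real p - 1) * ?Q - (real p + 1) / ((real p)\<^sup>2 * (real p - 1)) * ?S\<^sup>2"
    using p2 by (simp add: diff_divide_distrib)
  finally show ?thesis .
qed

text \<open>A general F covers both the mean, with the identity, and the variance, with the squared
  deviation.\<close>

lemma sum_vertices_trace_dist:
  assumes p: "Factorial_Ring.prime p" and N: "N \<ge> 1"
  shows "(\<Sum>\<beta>1\<in>vertices p N. \<Sum>\<beta>2\<in>vertices p N. F ((trace_dist p N \<beta>1 \<beta>2)\<^sup>2)) =
    sum_pairs {1..p-1} (\<lambda>s q. F (1 / (real p - 1) * q
      - (real p + 1) / ((real p)\<^sup>2 * (real p - 1)) * s\<^sup>2))"
  unfolding sum_pairs_def trace_dist_sign_vertex[OF assms, symmetric]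
    sum.reindex_bij_betw[OF bij_betw_sign_vertex[OF assms], symmetric] ..

lemma card_sign_vectors:
  assumes "finite I"
  shows "card (sign_vectors I) = 2 ^ card I"
  using assms by (simp add: sign_vectors_def card_PiE numeral_2_eq_2)

lemma card_vertices:
  assumes "Factorial_Ring.prime p" and "N \<ge> 1"
  shows "card (vertices p N) = 2 ^ (p - 1)"
  using bij_betw_same_card[OF bij_betw_sign_vertex[OF assms]] by (simp add: card_sign_vectors)

section \<open>Mean and variance of the squared distance\<close>

lemma mean_sq_dist_eq:
  assumes p: "Factorial_Ring.prime p" and N: "N \<ge> 1"
  shows "mean_sq_dist p N = ((real p)\<^sup>2 - real p - 1) / (2 * (real p)\<^sup>2)"
proof -
  have p2: "real p \<ge> 2" using prime_ge_2_nat[OF p] by simp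
  let ?a = "1 / (real p - 1)" and ?b = "(real p + 1) / ((real p)\<^sup>2 * (real p - 1))"
  have "mean_sq_dist p N = (?a - ?b) * (real p - 1) / 2"
    using p2 unfolding mean_sq_dist_def card_vertices[OF assms]
      sum_vertices_trace_dist[OF assms, of "\<lambda>x. x"] sum_pairs_mean[OF finite_atLeastAtMost]
    by (simp add: of_nat_diff power2_eq_square flip: power_mult_distrib)
  also have "\<dots> = (?a * (real p - 1) - ?b * (real p - 1)) / 2" by (simp only: left_diff_distrib)
  also have "?a * (real p - 1) = 1" using p2 by simp
  also have "?b * (real p - 1) = (real p + 1) / (real p)\<^sup>2" using p2 by simp
  also have "(1 - (real p + 1) / (real p)\<^sup>2) / 2 = ((real p)\<^sup>2 - real p - 1) / (2 * (real p)\<^sup>2)"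
    using p2 by (simp add: field_simps)
  finally show ?thesis .
qed

lemma variance_sq_dist:
  assumes p: "Factorial_Ring.prime p" and N: "N \<ge> 1"
  shows "(\<Sum>\<beta>1\<in>vertices p N. \<Sum>\<beta>2\<in>vertices p N. ((trace_dist p N \<beta>1 \<beta>2)\<^sup>2 - mean_sq_dist p N)\<^sup>2) =
    4 ^ (p - 1) * ((real p ^ 4 - (real p)\<^sup>2 - 4 * real p - 3) / (4 * real p ^ 4 * (real p - 1)))"
proof -
  have p2: "real p \<ge> 2" using prime_ge_2_nat[OF p] by simp
  define r where "r = real p"
  have r: "r \<noteq> 0" "r - 1 \<noteq> 0" using p2 by (auto simp: r_def)
  define a where "a = 1 / (r - 1)"
  define b where "b = (r + 1) / (r\<^sup>2 * (r - 1))"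
  have an: "a * (r - 1) = 1" and bn: "b * (r\<^sup>2 * (r - 1)) = r + 1" using r by (auto simp: a_def b_def)
  have n: "real (card {1..p-1}) = r - 1" using p2 by (simp add: r_def of_nat_diff)
  have mean: "mean_sq_dist p N = (a - b) * (r - 1) / 2"
  proof -
    have "b * (r - 1) = (r + 1) / r\<^sup>2" using r by (simp add: b_def)
    then have "(a - b) * (r - 1) / 2 = (1 - (r + 1) / r\<^sup>2) / 2" by (simp only: left_diff_distrib an)
    then show ?thesis unfolding mean_sq_dist_eq[OF assms] r_def[symmetric] using r by (simp add: field_simps)
  qed
  have "(\<Sum>\<beta>1\<in>vertices p N. \<Sum>\<beta>2\<in>vertices p N. ((trace_dist p N \<beta>1 \<beta>2)\<^sup>2 - mean_sq_dist p N)\<^sup>2) =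
      sum_pairs {1..p-1} (\<lambda>s q. (a * q - b * s\<^sup>2 - (a - b) * (r - 1) / 2)\<^sup>2)"
    using sum_vertices_trace_dist[OF assms, of "\<lambda>x. (x - mean_sq_dist p N)\<^sup>2"]
    by (simp only: mean a_def b_def r_def)
  also have "\<dots> = 4 ^ card {1..p-1} *
      ((a\<^sup>2 * (r - 1) - 2 * a * b * (r - 1) + b\<^sup>2 * (2 * (r - 1)\<^sup>2 - (r - 1))) / 4)"
    using sum_pairs_variance[of "{1..p-1}" a b] unfolding n by simp
  also have "a\<^sup>2 * (r - 1) - 2 * a * b * (r - 1) + b\<^sup>2 * (2 * (r - 1)\<^sup>2 - (r - 1)) =
      (r ^ 4 - r\<^sup>2 - 4 * r - 3) / (r ^ 4 * (r - 1))"
  proof -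
    \<comment> \<open>Clearing the denominator regroups everything in terms of
      \<open>a * (r - 1)\<close> and \<open>b * (r^2 * (r - 1))\<close>, whose values are 1 and
      \<open>r + 1\<close>.\<close>
    have "(a\<^sup>2 * (r - 1) - 2 * a * b * (r - 1) + b\<^sup>2 * (2 * (r - 1)\<^sup>2 - (r - 1))) * (r ^ 4 * (r - 1)) =
        r ^ 4 * (a * (r - 1))\<^sup>2 - 2 * r\<^sup>2 * (a * (r - 1)) * (b * (r\<^sup>2 * (r - 1)))
        + (b * (r\<^sup>2 * (r - 1)))\<^sup>2 * (2 * r - 3)"
      by (simp add: algebra_simps power2_eq_square power4_eq_xxxx)
    also have "\<dots> = r ^ 4 - r\<^sup>2 - 4 * r - 3"
      unfolding an bn by (simp add: algebra_simps power2_eq_square power4_eq_xxxx)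
    finally show ?thesis using r by (simp add: eq_divide_eq)
  qed
  finally show ?thesis by (simp add: r_def mult_ac)
qed

theorem theorem8:
  fixes \<eta> :: real and N p :: nat
  assumes "0 < \<eta>" and "\<eta> < 1 / 2"
    and "N \<ge> 1"
    and "Factorial_Ring.prime p" and "odd p"
  shows "1 / (real (card (vertices p N)))\<^sup>2 *
           real (card {(\<beta>1, \<beta>2) \<in> vertices p N \<times> vertices p N.
             trace_dist p N \<beta>1 \<beta>2 \<in>
               {sqrt (mean_sq_dist p N) - real p powr (- \<eta>) ..
                sqrt (mean_sq_dist p N) + real p powr (- \<eta>)}})
         \<ge> 1 - 2 / real p powr (1 - 2 * \<eta>)"
proof -
  note pN = \<open>Factorial_Ring.prime p\<close> \<open>N \<ge> 1\<close>
  define r where "r = real p"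
  define A where "A = mean_sq_dist p N"
  define Y where "Y = vertices p N \<times> vertices p N"
  define d where "d = (\<lambda>(\<beta>1, \<beta>2). trace_dist p N \<beta>1 \<beta>2)"
  \<comment> \<open>Oddness enters through \<open>r \<ge> 3\<close>, used for the positivity of A
    and in the variance bound.\<close>
  have "p \<noteq> 2" using \<open>odd p\<close> by auto
  then have "p \<ge> 3" using prime_ge_2_nat[OF pN(1)] by linarith
  then have r: "r \<ge> 3" by (simp add: r_def)
  have A: "A = (r\<^sup>2 - r - 1) / (2 * r\<^sup>2)" by (simp add: A_def r_def mean_sq_dist_eq[OF pN])
  have r2: "r\<^sup>2 \<ge> 3 * r" using r by (simp add: power2_eq_square)
  have "A > 0" unfolding A using r r2 by (intro divide_pos_pos) auto
  have cardY: "card Y = (card (vertices p N))\<^sup>2" "real (card Y) = 4 ^ (p - 1)"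
    by (simp_all add: Y_def card_cartesian_product power2_eq_square card_vertices[OF pN]
        power_mult_distrib[symmetric])
  \<comment> \<open>An infinite set would have cardinality 0, not a power of 2.\<close>
  have "finite (vertices p N)" using card_vertices[OF pN] by (metis card.infinite power_not_zero zero_neq_numeral)
  then have fin: "finite Y" by (simp add: Y_def)
  have d0: "d x \<ge> 0" for x
    using r by (auto simp: d_def trace_dist_def trace_norm_def r_def sum_nonneg split: prod.split
        intro!: divide_nonneg_nonneg mult_nonneg_nonneg)
  have "(\<Sum>x\<in>Y. ((d x)\<^sup>2 - A)\<^sup>2) =
      (\<Sum>\<beta>1\<in>vertices p N. \<Sum>\<beta>2\<in>vertices p N. ((trace_dist p N \<beta>1 \<beta>2)\<^sup>2 - A)\<^sup>2)"
    by (simp add: Y_def d_def sum.cartesian_product case_prod_beta)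
  also have "\<dots> = card Y * ((r ^ 4 - r\<^sup>2 - 4 * r - 3) / (4 * r ^ 4 * (r - 1)))"
    unfolding A_def variance_sq_dist[OF pN] cardY(2) r_def ..
  \<comment> \<open>The factor \<open>2 / r\<close> becomes v in \<open>chebyshev_sqrt\<close> and
    is the source of the constant 2 in the conclusion.\<close>
  also have "\<dots> \<le> card Y * (A * (2 / r))"
  proof (intro mult_left_mono)
    have "(r ^ 4 - r\<^sup>2 - 4 * r - 3) / (4 * r ^ 4 * (r - 1)) \<le> r ^ 4 / (4 * r ^ 4 * (r - 1))"
      using r r2 by (intro divide_right_mono) auto
    also have "\<dots> = 1 / (4 * (r - 1))" using r by simp
    also have "\<dots> \<le> (r\<^sup>2 - r - 1) / r ^ 3"
    proof -
      \<comment> \<open>The right side of the next inequality exceeds the left by exactly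
        \<open>r^2 * (3 * r - 8) + 4\<close>.\<close>
      have "0 \<le> r\<^sup>2 * (3 * r - 8)" using r by simp
      then have "r ^ 3 \<le> (r\<^sup>2 - r - 1) * (4 * (r - 1))"
        by (simp add: algebra_simps power2_eq_square power3_eq_cube)
      then show ?thesis using r by (simp add: divide_le_eq pos_le_divide_eq mult.commute)
    qed
    also have "\<dots> = A * (2 / r)" using r unfolding A
      by (simp add: frac_eq_eq algebra_simps power2_eq_square power3_eq_cube)
    finally show "(r ^ 4 - r\<^sup>2 - 4 * r - 3) / (4 * r ^ 4 * (r - 1)) \<le> A * (2 / r)" .
  qed simp
  finally have var: "(\<Sum>x\<in>Y. ((d x)\<^sup>2 - A)\<^sup>2) \<le> card Y * (A * (2 / r))" .
  have t: "r powr (- \<eta>) > 0" using r by simp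
  have "card Y * (1 - (2 / r) / (r powr (- \<eta>))\<^sup>2) \<le>
      card {x \<in> Y. d x \<in> {sqrt A - r powr (- \<eta>)..sqrt A + r powr (- \<eta>)}}"
    by (rule chebyshev_sqrt[OF fin d0 \<open>A > 0\<close> t var])
  moreover have "(2 / r) / (r powr (- \<eta>))\<^sup>2 = 2 / r powr (1 - 2 * \<eta>)"
  proof -
    have "r * (r powr (- \<eta>))\<^sup>2 = r powr 1 * (r powr (- \<eta>) * r powr (- \<eta>))"
      using r by (simp add: power2_eq_square)
    also have "\<dots> = r powr (1 + (- \<eta> + - \<eta>))" by (simp only: powr_add)
    also have "1 + (- \<eta> + - \<eta>) = 1 - 2 * \<eta>" by simp
    finally show ?thesis by simp
  qed
  moreover have "{x \<in> Y. d x \<in> {sqrt A - r powr (- \<eta>)..sqrt A + r powr (- \<eta>)}} =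
      {(\<beta>1, \<beta>2) \<in> vertices p N \<times> vertices p N. trace_dist p N \<beta>1 \<beta>2 \<in>
        {sqrt A - r powr (- \<eta>)..sqrt A + r powr (- \<eta>)}}"
    by (auto simp: Y_def d_def)
  moreover have "real (card Y) > 0" by (simp add: cardY(2))
  ultimately show ?thesis
    unfolding A_def r_def using cardY(1) by (simp add: field_simps)
qed

end
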